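(* Let $\{\Omega_i\}_{i=1}^N$ be a compatible finite partition of a bounded Lipschitz domain $\Omega\subset\mathbb R^d$, and let each $\Omega_i$ carry an open local subsystem $\mathsf T_{\Omega_i}$ whose trajectory $u_i$ satisfies the local open balance $$\frac{d}{dt}\mathcal F_i[u_i(t)]=-\mathcal D_i[u_i(t)]+\mathcal B_i^{\mathrm{ext}}[u_i(t)]+\mathcal B_i^{\Gamma}[u_i(t)]+\mathcal S_i[u_i(t)].$$ Assume that on every nonempty interface $\Gamma_{ij}$ the subsystem trajectories satisfy a power-conserving interconnection relation $\mathfrak I_{ij}$. Then the composite system with total storage, dissipation, source, and external boundary exchange $$\mathcal F_\#[u_1,\dots,u_N]:=\sum_{i=1}^N\mathcal F_i[u_i],\quad \mathcal D_\#[u_1,\dots,u_N]:=\sum_{i=1}^N\mathcal D_i[u_i],$$ $$\mathcal S_\#[u_1,\dots,u_N]:=\sum_{i=1}^N\mathcal S_i[u_i],\quad \mathcal B_\#[u_1,\dots,u_N]:=\sum_{i=1}^N\mathcal B_i^{\mathrm{ext}}[u_i]$$ satisfies $$\frac{d}{dt}\mathcal F_\#[u_1(t),\dots,u_N(t)]=-\mathcal D_\#[u_1(t),\dots,u_N(t)]+\mathcal B_\#[u_1(t),\dots,u_N(t)]+\mathcal S_\#[u_1(t),\dots,u_N(t)].$$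
   Context: A finite family $\{\Omega_i\}_{i=1}^N$ of Lipschitz subdomains of $\Omega$ is a compatible finite partition of $\Omega$ if: (i) $\overline\Omega=\bigcup_{i=1}^N\overline{\Omega_i}$; (ii) the interiors of the $\Omega_i$ are pairwise disjoint; (iii) each $\Omega_i$ is Lipschitz; (iv) for each $i\ne j$ the interface $\Gamma_{ij}:=\partial\Omega_i\cap\partial\Omega_j\cap\Omega$ is either empty or a Lipschitz hypersurface on which the outer normals satisfy $n_j=-n_i$ a.e. An open local subsystem on a Lipschitz domain $\Omega_i\subseteq\Omega$ consists of a state space $\mathcal X_i$, real-valued functionals $\mathcal F_i,\mathcal D_i,\mathcal S_i,\mathcal B_i^{\mathrm{ext}}$ on $\mathcal X_i$ (storage, dissipation, source, external boundary exchange), and interface port spaces $Y_{e,\Omega_i}^{\Gamma},Y_{f,\Omega_i}^{\Gamma}$ with a duality pairing $\langle\cdot,\cdot\rangle_{Y_{\Omega_i}^{\Gamma}}$ and port maps $e_i^\Gamma:\mathcal X_i\to Y_{e,\Omega_i}^\Gamma$, $f_i^\Gamma:\mathcal X_i\to Y_{f,\Omega_i}^\Gamma$, such that its trajectories $u_i$ satisfy the local open balance displayed in the claim, where $\mathcal B_i^\Gamma[u_i]:=\langle e_i^\Gamma[u_i],f_i^\Gamma[u_i]\rangle_{Y_{\Omega_i}^\Gamma}$. The interface ports of $\Omega_i$ are split by interfaces: for each nonempty $\Gamma_{ij}$ there are port spaces $Y_{e,\Omega_i}^{\Gamma_{ij}},Y_{f,\Omega_i}^{\Gamma_{ij}}$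 with duality pairing $\langle\cdot,\cdot\rangle_{Y_{\Omega_i}^{\Gamma_{ij}}}$ and port variables $e_i^{\Gamma_{ij}}[u_i],f_i^{\Gamma_{ij}}[u_i]$, and $\mathcal B_i^\Gamma[u_i]=\sum_{j\neq i,\ \Gamma_{ij}\ne\emptyset}\langle e_i^{\Gamma_{ij}}[u_i],f_i^{\Gamma_{ij}}[u_i]\rangle_{Y_{\Omega_i}^{\Gamma_{ij}}}$. A (power-conserving) interface interconnection relation on a nonempty $\Gamma_{ij}$ is a subset $\mathfrak I_{ij}\subset Y_{e,\Omega_i}^{\Gamma_{ij}}\times Y_{f,\Omega_i}^{\Gamma_{ij}}\times Y_{e,\Omega_j}^{\Gamma_{ij}}\times Y_{f,\Omega_j}^{\Gamma_{ij}}$ such that every $(\eta_i,\zeta_i,\eta_j,\zeta_j)\in\mathfrak I_{ij}$ satisfies $\langle\eta_i,\zeta_i\rangle_{Y_{\Omega_i}^{\Gamma_{ij}}}+\langle\eta_j,\zeta_j\rangle_{Y_{\Omega_j}^{\Gamma_{ij}}}=0$. The subsystem trajectories satisfy $\mathfrak I_{ij}$ if $(e_i^{\Gamma_{ij}}[u_i(t)],f_i^{\Gamma_{ij}}[u_i(t)],e_j^{\Gamma_{ij}}[u_j(t)],f_j^{\Gamma_{ij}}[u_j(t)])\in\mathfrak I_{ij}$ for all $t$. *)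

theory Defs
  imports "HOL-Analysis.Analysis"
begin

definition orth_part :: "'a::euclidean_space \<Rightarrow> 'a \<Rightarrow> 'a" where
  "orth_part \<nu> x = x - (x \<bullet> \<nu>) *\<^sub>R \<nu>"

text \<open>A rotated coordinate system is given by its vertical unit vector \<open>\<nu>\<close>; the function
  \<open>\<gamma>\<close> is only relevant on the hyperplane orthogonal to \<open>\<nu>\<close>.\<close>

definition lipschitz_profile :: "'a::euclidean_space \<Rightarrow> ('a \<Rightarrow> real) \<Rightarrow> bool" where
  "lipschitz_profile \<nu> \<gamma> \<longleftrightarrow> norm \<nu> = 1 \<and> (\<exists>L. L-lipschitz_on {y. y \<bullet> \<nu> = 0} \<gamma>)"

definition local_subgraph ::
    "'a::euclidean_space set \<Rightarrow> 'a \<Rightarrow> 'a set \<Rightarrow> 'a \<Rightarrow> ('a \<Rightarrow> real) \<Rightarrow> bool" where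
  "local_subgraph A p U \<nu> \<gamma> \<longleftrightarrow>
     open U \<and> p \<in> U \<and> lipschitz_profile \<nu> \<gamma> \<and>
     A \<inter> U = {x \<in> U. x \<bullet> \<nu> < \<gamma> (orth_part \<nu> x)}"

definition lipschitz_domain :: "'a::euclidean_space set \<Rightarrow> bool" where
  "lipschitz_domain A \<longleftrightarrow>
     open A \<and> connected A \<and> A \<noteq> {} \<and> (\<forall>p \<in> frontier A. \<exists>U \<nu> \<gamma>. local_subgraph A p U \<nu> \<gamma>)"

text \<open>Near each of its points a Lipschitz hypersurface is the graph of a Lipschitz function,
  either over the whole hyperplane orthogonal to \<open>\<nu>\<close>, or, at a boundary point of the
  hypersurface, over a Lipschitz subgraph region of that hyperplane. Boundary points have to be
  admitted because an interface \<open>\<partial>A \<inter> \<partial>B \<inter> \<Omega>\<close> contains the interior junctions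
  at which three or more subdomains meet.\<close>

definition lipschitz_hypersurface :: "'a::euclidean_space set \<Rightarrow> bool" where
  "lipschitz_hypersurface S \<longleftrightarrow>
     (\<forall>p \<in> S. \<exists>U \<nu> \<gamma>. open U \<and> p \<in> U \<and> lipschitz_profile \<nu> \<gamma> \<and>
        (S \<inter> U = {x \<in> U. x \<bullet> \<nu> = \<gamma> (orth_part \<nu> x)} \<or>
         (\<exists>\<mu> \<beta> L. norm \<mu> = 1 \<and> \<mu> \<bullet> \<nu> = 0 \<and>
            L-lipschitz_on {z. z \<bullet> \<nu> = 0 \<and> z \<bullet> \<mu> = 0} \<beta> \<and>
            S \<inter> U = {x \<in> U. x \<bullet> \<nu> = \<gamma> (orth_part \<nu> x) \<and>
                             x \<bullet> \<mu> \<le> \<beta> (orth_part \<mu> (orth_part \<nu> x))})))"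

text \<open>Where \<open>A\<close> is locally \<open>{x. x \<bullet> \<nu> < \<gamma> (orth_part \<nu> x)}\<close> and \<open>\<gamma>\<close> has gradient
  \<open>g\<close>, the outer unit normal is \<open>(\<nu> - g) / sqrt (1 + |g|\<^sup>2)\<close>; here \<open>g\<close> is orthogonal to
  \<open>\<nu>\<close> because the differentiated function does not vary in direction \<open>\<nu>\<close>.\<close>

definition outer_normal :: "'a::euclidean_space set \<Rightarrow> 'a \<Rightarrow> 'a \<Rightarrow> bool" where
  "outer_normal A p n \<longleftrightarrow> p \<in> frontier A \<and>
     (\<exists>U \<nu> \<gamma> g. local_subgraph A p U \<nu> \<gamma> \<and>
        ((\<lambda>x. \<gamma> (orth_part \<nu> x)) has_derivative (\<lambda>h. g \<bullet> h)) (at p) \<and>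
        n = (1 / norm (\<nu> - g)) *\<^sub>R (\<nu> - g))"

text \<open>The \<open>k\<close>-dimensional Hausdorff (outer) measure. The empty set is treated separately
  because \<open>0 ^ 0 = 1\<close>.\<close>

definition hausdorff_measure :: "nat \<Rightarrow> 'a::metric_space set \<Rightarrow> ennreal" where
  "hausdorff_measure k A =
     (SUP \<delta> \<in> {0::real<..}.
        INF C \<in> {C :: nat \<Rightarrow> 'a set. A \<subseteq> (\<Union>m. C m) \<and> (\<forall>m. bounded (C m) \<and> diameter (C m) \<le> \<delta>)}.
          (\<Sum>m. if C m = {} then 0
                else ennreal (unit_ball_vol (real k) * (diameter (C m) / 2) ^ k)))"

definition interface :: "'a::euclidean_space set \<Rightarrow> 'a set \<Rightarrow> 'a set \<Rightarrow> 'a set" where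
  "interface \<Omega> A B = frontier A \<inter> frontier B \<inter> \<Omega>"

text \<open>``Almost everywhere'' refers to the surface measure, i.e. the Hausdorff measure of
  codimension one.\<close>

definition compatible_partition ::
    "'a::euclidean_space set \<Rightarrow> nat \<Rightarrow> (nat \<Rightarrow> 'a set) \<Rightarrow> bool" where
  "compatible_partition \<Omega> N D \<longleftrightarrow>
     (\<forall>i \<in> {1..N}. D i \<subseteq> \<Omega>) \<and>
     closure \<Omega> = (\<Union>i \<in> {1..N}. closure (D i)) \<and>
     (\<forall>i \<in> {1..N}. \<forall>j \<in> {1..N}. i \<noteq> j \<longrightarrow> interior (D i) \<inter> interior (D j) = {}) \<and>
     (\<forall>i \<in> {1..N}. lipschitz_domain (D i)) \<and>
     (\<forall>i \<in> {1..N}. \<forall>j \<in> {1..N}. i \<noteq> j \<longrightarrow>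
        interface \<Omega> (D i) (D j) = {} \<or>
        (lipschitz_hypersurface (interface \<Omega> (D i) (D j)) \<and>
         hausdorff_measure (DIM('a) - 1)
           {p \<in> interface \<Omega> (D i) (D j).
              \<not> (\<exists>n. outer_normal (D i) p n \<and> outer_normal (D j) p (- n))} = 0))"

text \<open>Port spaces are linear subspaces of ambient real vector spaces, and state spaces are subsets
  of an ambient type, so that the finitely many subsystems may have different spaces
  (any family of vector spaces embeds into its direct sum).\<close>

record ('x, 'e, 'f) port =
  effort_space :: "'e set"
  flow_space :: "'f set"
  pairing :: "'e \<Rightarrow> 'f \<Rightarrow> real"
  effort :: "'x \<Rightarrow> 'e"
  flow :: "'x \<Rightarrow> 'f"

text \<open>\<open>iface_port T j\<close> is the port of \<open>T\<close> on its interface with the \<open>j\<close>-th subdomain.\<close>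

record ('x, 'e, 'f) subsystem =
  state_space :: "'x set"
  trajectories :: "(real \<Rightarrow> 'x) set"
  storage :: "'x \<Rightarrow> real"
  dissipation :: "'x \<Rightarrow> real"
  source :: "'x \<Rightarrow> real"
  ext_exchange :: "'x \<Rightarrow> real"
  total_port :: "('x, 'e, 'f) port"
  iface_port :: "nat \<Rightarrow> ('x, 'e, 'f) port"

definition duality_pairing ::
    "'e::real_vector set \<Rightarrow> 'f::real_vector set \<Rightarrow> ('e \<Rightarrow> 'f \<Rightarrow> real) \<Rightarrow> bool" where
  "duality_pairing E F b \<longleftrightarrow>
     subspace E \<and> subspace F \<and>
     (\<forall>x \<in> E. \<forall>x' \<in> E. \<forall>y \<in> F. b (x + x') y = b x y + b x' y) \<and>
     (\<forall>x \<in> E. \<forall>y \<in> F. \<forall>y' \<in> F. b x (y + y') = b x y + b x y') \<and>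
     (\<forall>c. \<forall>x \<in> E. \<forall>y \<in> F. b (c *\<^sub>R x) y = c * b x y \<and> b x (c *\<^sub>R y) = c * b x y) \<and>
     (\<forall>x \<in> E. (\<forall>y \<in> F. b x y = 0) \<longrightarrow> x = 0) \<and>
     (\<forall>y \<in> F. (\<forall>x \<in> E. b x y = 0) \<longrightarrow> y = 0)"

definition port_on :: "'x set \<Rightarrow> ('x, 'e::real_vector, 'f::real_vector) port \<Rightarrow> bool" where
  "port_on X P \<longleftrightarrow>
     duality_pairing (effort_space P) (flow_space P) (pairing P) \<and>
     (\<forall>x \<in> X. effort P x \<in> effort_space P \<and> flow P x \<in> flow_space P)"

definition port_power :: "('x, 'e, 'f) port \<Rightarrow> 'x \<Rightarrow> real" where
  "port_power P x = pairing P (effort P x) (flow P x)"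

definition iface_exchange :: "('x, 'e, 'f) subsystem \<Rightarrow> 'x \<Rightarrow> real" where
  "iface_exchange T x = port_power (total_port T) x"

definition local_open_balance ::
    "real set \<Rightarrow> ('x, 'e, 'f) subsystem \<Rightarrow> (real \<Rightarrow> 'x) \<Rightarrow> bool" where
  "local_open_balance I T u \<longleftrightarrow>
     (\<forall>t \<in> I. ((\<lambda>s. storage T (u s)) has_real_derivative
        - dissipation T (u t) + ext_exchange T (u t) + iface_exchange T (u t) + source T (u t))
        (at t within I))"

definition open_local_subsystem ::
    "'a::euclidean_space set \<Rightarrow> real set \<Rightarrow> ('x, 'e::real_vector, 'f::real_vector) subsystem \<Rightarrow> bool" where
  "open_local_subsystem A I T \<longleftrightarrow>
     lipschitz_domain A \<and>
     port_on (state_space T) (total_port T) \<and>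
     (\<forall>u \<in> trajectories T. (\<forall>t \<in> I. u t \<in> state_space T) \<and> local_open_balance I T u)"

definition ports_split_by_interfaces ::
    "'a::euclidean_space set \<Rightarrow> nat \<Rightarrow> (nat \<Rightarrow> 'a set) \<Rightarrow> nat \<Rightarrow>
     ('x, 'e::real_vector, 'f::real_vector) subsystem \<Rightarrow> bool" where
  "ports_split_by_interfaces \<Omega> N D i T \<longleftrightarrow>
     (\<forall>j \<in> {1..N}. j \<noteq> i \<and> interface \<Omega> (D i) (D j) \<noteq> {} \<longrightarrow>
        port_on (state_space T) (iface_port T j)) \<and>
     (\<forall>x \<in> state_space T. iface_exchange T x =
        (\<Sum>j \<in> {j \<in> {1..N}. j \<noteq> i \<and> interface \<Omega> (D i) (D j) \<noteq> {}}. port_power (iface_port T j) x))"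

definition power_conserving_relation ::
    "('x, 'e, 'f) port \<Rightarrow> ('x, 'e, 'f) port \<Rightarrow> ('e \<times> 'f \<times> 'e \<times> 'f) set \<Rightarrow> bool" where
  "power_conserving_relation P Q J \<longleftrightarrow>
     J \<subseteq> effort_space P \<times> flow_space P \<times> effort_space Q \<times> flow_space Q \<and>
     (\<forall>(\<eta>, \<zeta>, \<eta>', \<zeta>') \<in> J. pairing P \<eta> \<zeta> + pairing Q \<eta>' \<zeta>' = 0)"

definition satisfies_relation ::
    "real set \<Rightarrow> ('x, 'e, 'f) port \<Rightarrow> ('x, 'e, 'f) port \<Rightarrow> ('e \<times> 'f \<times> 'e \<times> 'f) set \<Rightarrow>
     (real \<Rightarrow> 'x) \<Rightarrow> (real \<Rightarrow> 'x) \<Rightarrow> bool" where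
  "satisfies_relation I P Q J u v \<longleftrightarrow>
     (\<forall>t \<in> I. (effort P (u t), flow P (u t), effort Q (v t), flow Q (v t)) \<in> J)"

definition total_storage :: "nat \<Rightarrow> (nat \<Rightarrow> ('x, 'e, 'f) subsystem) \<Rightarrow> (nat \<Rightarrow> 'x) \<Rightarrow> real" where
  "total_storage N T x = (\<Sum>i = 1..N. storage (T i) (x i))"

definition total_dissipation :: "nat \<Rightarrow> (nat \<Rightarrow> ('x, 'e, 'f) subsystem) \<Rightarrow> (nat \<Rightarrow> 'x) \<Rightarrow> real" where
  "total_dissipation N T x = (\<Sum>i = 1..N. dissipation (T i) (x i))"

definition total_source :: "nat \<Rightarrow> (nat \<Rightarrow> ('x, 'e, 'f) subsystem) \<Rightarrow> (nat \<Rightarrow> 'x) \<Rightarrow> real" where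
  "total_source N T x = (\<Sum>i = 1..N. source (T i) (x i))"

definition total_ext_exchange :: "nat \<Rightarrow> (nat \<Rightarrow> ('x, 'e, 'f) subsystem) \<Rightarrow> (nat \<Rightarrow> 'x) \<Rightarrow> real" where
  "total_ext_exchange N T x = (\<Sum>i = 1..N. ext_exchange (T i) (x i))"

end

theory Submission
  imports Defs
begin

text \<open>The derivative of the total storage is the sum of the local balances, so the claim amounts
  to the interface exchanges of all subsystems summing to zero at each time. Splitting each of
  these exchanges over its interfaces turns their sum into a sum of port powers over ordered pairs
  of subdomains with a common nonempty interface. Such pairs come in twos, \<open>(i, j)\<close> and
  \<open>(j, i)\<close>, which refer to the same interface because \<open>\<partial>\<Omega>\<^sub>i \<inter> \<partial>\<Omega>\<^sub>j \<inter> \<Omega>\<close> is symmetric in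
  \<open>i\<close> and \<open>j\<close>, and power conservation says that the two powers cancel.\<close>

text \<open>Exchanging the order of summation turns the sum into its own negative.\<close>

lemma sum_antisymmetric_eq_0:
  fixes p :: "'i \<Rightarrow> 'i \<Rightarrow> real"
  assumes "finite S"
    and sym: "\<And>i j. R i j \<Longrightarrow> R j i"
    and anti: "\<And>i j. \<lbrakk>i \<in> S; j \<in> S; R i j\<rbrakk> \<Longrightarrow> p i j + p j i = 0"
  shows "(\<Sum>i\<in>S. \<Sum>j\<in>{j \<in> S. R i j}. p i j) = 0"
proof -
  let ?X = "\<Sum>i\<in>S. \<Sum>j\<in>{j \<in> S. R i j}. p i j"
  have "?X = (\<Sum>j\<in>S. \<Sum>i\<in>{i \<in> S. R i j}. p i j)"
    using \<open>finite S\<close> by (rule sum.swap_restrict[OF _ \<open>finite S\<close>])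
  also have "\<dots> = (\<Sum>j\<in>S. \<Sum>i\<in>{i \<in> S. R j i}. - p j i)"
  proof (intro sum.cong refl)
    show "{i \<in> S. R i j} = {i \<in> S. R j i}" for j
      using sym by blast
    show "p i j = - p j i" if "j \<in> S" "i \<in> {i \<in> S. R j i}" for i j
      using anti[of j i] that by simp
  qed
  also have "\<dots> = - ?X"
    by (simp add: sum_negf)
  finally show ?thesis
    by simp
qed

lemma interface_commute: "interface \<Omega> A B = interface \<Omega> B A"
  by (auto simp: interface_def)

lemma port_powers_cancel:
  assumes "power_conserving_relation P Q J" and "satisfies_relation I P Q J u v" and "t \<in> I"
  shows "port_power P (u t) + port_power Q (v t) = 0"
  using assms
  unfolding power_conserving_relation_def satisfies_relation_def port_power_def by fast

text \<open>The sum ranges over both orientations of an interface, whereas an interconnection relation is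
  given once per interface, for \<open>i < j\<close>; the other orientation follows by commuting the two
  powers.\<close>

lemma sum_iface_exchange_eq_0:
  assumes split: "\<And>i. i \<in> {1..N} \<Longrightarrow> ports_split_by_interfaces \<Omega> N D i (T i)"
    and state: "\<And>i. i \<in> {1..N} \<Longrightarrow> u i t \<in> state_space (T i)"
    and cons: "\<And>i j. \<lbrakk>i \<in> {1..N}; j \<in> {1..N}; i < j; interface \<Omega> (D i) (D j) \<noteq> {}\<rbrakk> \<Longrightarrow>
           power_conserving_relation (iface_port (T i) j) (iface_port (T j) i) (J i j)"
    and rel: "\<And>i j. \<lbrakk>i \<in> {1..N}; j \<in> {1..N}; i < j; interface \<Omega> (D i) (D j) \<noteq> {}\<rbrakk> \<Longrightarrow>
           satisfies_relation I (iface_port (T i) j) (iface_port (T j) i) (J i j) (u i) (u j)"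
    and "t \<in> I"
  shows "(\<Sum>i = 1..N. iface_exchange (T i) (u i t)) = 0"
proof -
  let ?R = "\<lambda>i j. j \<noteq> i \<and> interface \<Omega> (D i) (D j) \<noteq> {}"
  let ?p = "\<lambda>i j. port_power (iface_port (T i) j) (u i t)"
  have ordered: "?p i j + ?p j i = 0"
    if "i \<in> {1..N}" "j \<in> {1..N}" "i < j" "interface \<Omega> (D i) (D j) \<noteq> {}" for i j
    using port_powers_cancel[OF cons[OF that] rel[OF that] \<open>t \<in> I\<close>] .
  have "(\<Sum>i = 1..N. iface_exchange (T i) (u i t))
      = (\<Sum>i = 1..N. \<Sum>j\<in>{j \<in> {1..N}. ?R i j}. ?p i j)"
    using split state by (intro sum.cong refl) (simp add: ports_split_by_interfaces_def)
  also have "\<dots> = 0"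
  proof (rule sum_antisymmetric_eq_0)
    show "?R j i" if "?R i j" for i j
      using that interface_commute by metis
    show "?p i j + ?p j i = 0" if "i \<in> {1..N}" "j \<in> {1..N}" "?R i j" for i j
    proof (cases "i < j")
      case True
      then show ?thesis
        using ordered that by blast
    next
      case False
      then have "?p j i + ?p i j = 0"
        using that by (intro ordered) (auto simp: interface_commute[of \<Omega> "D j"])
      then show ?thesis
        by simp
    qed
  qed simp
  finally show ?thesis .
qed

theorem theorem4p13:
  fixes \<Omega> :: "(real ^ 'd) set"
    and N :: nat
    and D :: "nat \<Rightarrow> (real ^ 'd) set"
    and I :: "real set"
    and T :: "nat \<Rightarrow> ('x, 'e::real_vector, 'f::real_vector) subsystem"
    and u :: "nat \<Rightarrow> real \<Rightarrow> 'x"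
    and J :: "nat \<Rightarrow> nat \<Rightarrow> ('e \<times> 'f \<times> 'e \<times> 'f) set"
  assumes "bounded \<Omega>" and "lipschitz_domain \<Omega>"
    and "compatible_partition \<Omega> N D"
    and "is_interval I" and "interior I \<noteq> {}"
    and "\<And>i. i \<in> {1..N} \<Longrightarrow> open_local_subsystem (D i) I (T i)"
    and "\<And>i. i \<in> {1..N} \<Longrightarrow> ports_split_by_interfaces \<Omega> N D i (T i)"
    and "\<And>i. i \<in> {1..N} \<Longrightarrow> u i \<in> trajectories (T i)"
    and "\<And>i j. \<lbrakk>i \<in> {1..N}; j \<in> {1..N}; i < j; interface \<Omega> (D i) (D j) \<noteq> {}\<rbrakk> \<Longrightarrow>
           power_conserving_relation (iface_port (T i) j) (iface_port (T j) i) (J i j)"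
    and "\<And>i j. \<lbrakk>i \<in> {1..N}; j \<in> {1..N}; i < j; interface \<Omega> (D i) (D j) \<noteq> {}\<rbrakk> \<Longrightarrow>
           satisfies_relation I (iface_port (T i) j) (iface_port (T j) i) (J i j) (u i) (u j)"
  shows "\<forall>t \<in> I.
    ((\<lambda>s. total_storage N T (\<lambda>i. u i s)) has_real_derivative
       - total_dissipation N T (\<lambda>i. u i t) + total_ext_exchange N T (\<lambda>i. u i t)
       + total_source N T (\<lambda>i. u i t)) (at t within I)"
proof
  fix t
  assume t: "t \<in> I"
  have traj: "u i t \<in> state_space (T i)" "local_open_balance I (T i) (u i)" if "i \<in> {1..N}" for i
    using assms(6)[OF that] assms(8)[OF that] t by (auto simp: open_local_subsystem_def)
  have "((\<lambda>s. total_storage N T (\<lambda>i. u i s)) has_real_derivative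
      (\<Sum>i = 1..N. - dissipation (T i) (u i t) + ext_exchange (T i) (u i t)
         + iface_exchange (T i) (u i t) + source (T i) (u i t))) (at t within I)"
    unfolding total_storage_def
    using traj(2) t by (intro DERIV_sum) (simp add: local_open_balance_def)
  moreover have "(\<Sum>i = 1..N. iface_exchange (T i) (u i t)) = 0"
    using assms(7) traj(1) assms(9,10) t by (rule sum_iface_exchange_eq_0)
  ultimately show "((\<lambda>s. total_storage N T (\<lambda>i. u i s)) has_real_derivative
      - total_dissipation N T (\<lambda>i. u i t) + total_ext_exchange N T (\<lambda>i. u i t)
      + total_source N T (\<lambda>i. u i t)) (at t within I)"
    by (simp add: total_dissipation_def total_ext_exchange_def total_source_def
        sum.distrib sum_negf sum_subtractf)
qed

end
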